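(* Let $\boldsymbol v\in\mathbb R^3$ with $v:=|\boldsymbol v|<\sqrt2-1$, let $\lambda\in(0,1]$ satisfy $\lambda\le\frac1{1+v}$, and let $\kappa\ge\chi\ge0$, $\Delta t\ge0$, $\mathcal D_0\ge0$. Put $\mu_\chi=(1+\lambda\Delta t\,\chi)^{-1}$, $\mu_\kappa=(1+\lambda\Delta t\,\kappa)^{-1}$. For any given $\mathcal U^{*}=(\mathcal N^{*},\mathcal G^{*})\in\mathcal R$ and any $\mathcal M^{[0]}\in\mathcal R$, the iteration $\mathcal M^{[k+1]}=\mathcal Q(\mathcal M^{[k]})$, where $$\mathcal Q(\mathcal D,\mathcal I)=\begin{pmatrix}\mu_\chi\big[(1-\lambda)\mathcal D+\lambda(-v^i\mathcal I_i+\mathcal N^{*}+\Delta t\,\chi\mathcal D_0)\big]\\ \mu_\kappa\big[(1-\lambda)\mathcal I_j+\lambda(-v^i\mathsf k_{ij}(\mathcal D,\mathcal I)\mathcal D+\mathcal G^{*}_j)\big]\end{pmatrix},$$ converges as $k\to\infty$ to a unique $\mathcal M=(\mathcal D,\mathcal I)\in\mathcal R$. Further, the conserved moment $\mathcal U=(\mathcal D+v^i\mathcal I_i,\ \mathcal I_j+v^i\mathsf k_{ij}(\mathcal M)\mathcal D)$ associated with $\mathcal M$ is also in $\mathcal R$ and solves the implicit system $$\mathcal U=\mathcal U^{*}+\Delta t\,\big(\chi(\mathcal D_0-\mathcal D),\ -\kappa\,\mathcal I_j\big).$$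
   Context: $\mathcal R=\{(\mathcal D,\mathcal I)\in\mathbb R\times\mathbb R^3:\mathcal D>0,\ |\mathcal I|\le\mathcal D\}$. Repeated indices are summed over $1,2,3$, indices are raised/lowered with $\delta_{ij}$. For $\mathcal M=(\mathcal D,\mathcal I)\in\mathcal R$ let $h=|\mathcal I|/\mathcal D\in[0,1]$, $\hat n=\mathcal I/|\mathcal I|$, and $\mathsf k_{ij}(\mathcal M)=\frac12[(1-\psi(h))\delta_{ij}+(3\psi(h)-1)\hat n_i\hat n_j]$ (so $\mathsf k_{ij}=\delta_{ij}/3$ if $\mathcal I=0$), where $\psi$ is the Eddington factor of the (exact) Minerbo maximum-entropy closure: $\psi(h)=1-2h/\beta(h)$ for $h\in(0,1)$, with $\beta(h)=L^{-1}(h)$, $L(\beta)=\coth\beta-1/\beta$, and $\psi(0)=1/3$, $\psi(1)=1$. *)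

theory Defs
  imports "HOL-Analysis.Analysis"
begin

definition realizable :: "(real \<times> (real ^ 3)) set" where
  "realizable = {(D, I). 0 < D \<and> norm I \<le> D}"

definition langevin :: "real \<Rightarrow> real" where
  "langevin \<beta> = cosh \<beta> / sinh \<beta> - 1 / \<beta>"

text \<open>The Langevin function maps the positive half-line bijectively onto the open unit interval;
  \<open>langevin_inv\<close> is the inverse of that restriction and is meaningful only for \<open>0 < h < 1\<close>.\<close>

definition langevin_inv :: "real \<Rightarrow> real" where
  "langevin_inv = the_inv_into {0<..} langevin"

text \<open>Eddington factor of the Minerbo closure, meaningful for \<open>0 \<le> h \<le> 1\<close>.\<close>

definition eddington :: "real \<Rightarrow> real" where
  "eddington h = (if h = 0 then 1/3 else if h = 1 then 1 else 1 - 2 * h / langevin_inv h)"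

definition flux_factor :: "real \<times> (real ^ 3) \<Rightarrow> real" where
  "flux_factor = (\<lambda>(D, I). norm I / D)"

text \<open>For \<open>I = 0\<close> the direction \<open>sgn I = I /\<^sub>R norm I\<close> is \<open>0\<close>, and the formula
  below yields one third of the identity, see \<open>closure_tensor_zero\<close>.\<close>

definition closure_tensor :: "real \<times> (real ^ 3) \<Rightarrow> real ^ 3 ^ 3" where
  "closure_tensor M =
     (let \<psi> = eddington (flux_factor M); n = sgn (snd M)
      in \<chi> i j. 1/2 * ((1 - \<psi>) * (if i = j then 1 else 0) + (3 * \<psi> - 1) * (n $ i * n $ j)))"

lemma closure_tensor_zero: "closure_tensor (D, 0) = (1/3) *\<^sub>R mat 1"
  by (simp add: closure_tensor_def flux_factor_def eddington_def mat_def vec_eq_iff)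

text \<open>The vector with components \<open>v\<^sup>i k\<^sub>i\<^sub>j D\<close> is the row vector \<open>v\<close> times the tensor,
  scaled by \<open>D\<close>.\<close>

definition conserved :: "real ^ 3 \<Rightarrow> real \<times> (real ^ 3) \<Rightarrow> real \<times> (real ^ 3)" where
  "conserved v = (\<lambda>(D, I). (D + v \<bullet> I, I + D *\<^sub>R (v v* closure_tensor (D, I))))"

definition damping :: "real \<Rightarrow> real \<Rightarrow> real \<Rightarrow> real" where
  "damping lam dt s = inverse (1 + lam * dt * s)"

text \<open>\<open>chi\<close> and \<open>kappa\<close> are the opacities acting on density and flux, \<open>D0\<close> is the equilibrium
  density, and \<open>(N, G)\<close> are the given conserved moments.\<close>

definition iteration_map ::
  "real ^ 3 \<Rightarrow> real \<Rightarrow> real \<Rightarrow> real \<Rightarrow> real \<Rightarrow> real \<Rightarrow> real \<times> (real ^ 3)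
    \<Rightarrow> real \<times> (real ^ 3) \<Rightarrow> real \<times> (real ^ 3)" where
  "iteration_map v lam dt chi kappa D0 = (\<lambda>(N, G) (D, I).
     (damping lam dt chi * ((1 - lam) * D + lam * (- (v \<bullet> I) + N + dt * chi * D0)),
      damping lam dt kappa *\<^sub>R
        ((1 - lam) *\<^sub>R I + lam *\<^sub>R (- (D *\<^sub>R (v v* closure_tensor (D, I))) + G))))"

end

theory Submission
  imports Defs
begin

text \<open>
  The theorem is the contraction principle for the iteration map \<open>Q\<close> on the closed cone
  \<open>|I| \<le> D\<close>, in the Euclidean norm of \<open>(D, I)\<close>. Write \<open>P(M) v\<close> for the vector \<open>v\<^sup>i k\<^sub>i\<^sub>j(M) D\<close>
  (\<open>pressure\<close> below). Both damping factors are at most \<open>1\<close>, so \<open>Q\<close> is Lipschitz with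
  constant \<open>1 - \<lambda> + \<lambda> l\<close> as soon as \<open>(D, I) \<mapsto> (v \<bullet> I, P(D, I) v)\<close> is Lipschitz with
  constant \<open>l\<close>. The core is that \<open>l = (1 + sqrt 2) |v|\<close> is possible
  (\<open>moment_flux_lipschitz\<close>), and this is less than \<open>1\<close> exactly when \<open>|v| < sqrt 2 - 1\<close>.

  To get this constant, the Eddington factor is replaced by \<open>\<rho> = (3 \<psi> - 1) / 2\<close>
  (\<open>anisotropy\<close>), for which \<open>P(D, I) v = D v / 3 + D \<rho>(|I| / D) ((n \<bullet> v) n - v / 3)\<close> with
  \<open>n\<close> the direction of \<open>I\<close>. A change of \<open>M\<close> is split into a change of \<open>I\<close> at fixed density
  and a change of \<open>D\<close> at fixed flux. The first changes \<open>P(M) v\<close> by at most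
  \<open>2 |v|\<close> times its length, because \<open>0 \<le> \<rho>(h) \<le> h\<close> and \<open>\<rho>\<close> is monotone with slope at most \<open>3\<close>;
  the second by at most \<open>|v|\<close> times its length, again by these facts and \<open>\<rho> \<le> 1\<close>. The
  matrix with rows \<open>(0, 1)\<close> and \<open>(1, 2)\<close> that collects these bounds has Euclidean norm
  \<open>1 + sqrt 2\<close>. The finite differences are estimated directly, so the singular direction \<open>n\<close> at
  \<open>I = 0\<close> causes no trouble.

  That \<open>Q\<close> maps the cone into itself is the algebraic form of the fact that the moments of a
  nonnegative weight times a nonnegative angular distribution are realizable
  (\<open>norm_weighted_flux_le\<close>). The weights in question are \<open>1 - \<lambda> - \<lambda> v \<bullet> \<omega>\<close>, nonnegative
  because \<open>\<lambda> (1 + |v|) \<le> 1\<close>, and \<open>1 + v \<bullet> \<omega>\<close> for the conserved moments. The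
  only input about the closure is \<open>h\<^sup>2 \<le> \<psi>(h) \<le> 1\<close>. Finally a fixed point with \<open>D = 0\<close>
  is excluded by the density equation, and clearing the damping factors turns the fixed point
  equation into the implicit system.

  All facts about \<open>\<rho>\<close> come from inequalities for the Langevin function \<open>L\<close>, evaluated at
  \<open>\<beta>\<close> with \<open>L(\<beta>) = h\<close>, where \<open>\<rho> = 1 - 3 L(\<beta>) / \<beta>\<close>.\<close>

section \<open>Inequalities between hyperbolic functions\<close>

text \<open>The inequalities between hyperbolic functions are all proved by differentiating until the
  sign is obvious; each intermediate derivative vanishes or is nonnegative at \<open>0\<close>.\<close>

lemma nonneg_if_deriv_nonneg:
  fixes f f' :: "real \<Rightarrow> real"
  assumes "\<And>x. (f has_real_derivative f' x) (at x)"
    and "\<And>x. 0 \<le> x \<Longrightarrow> 0 \<le> f' x" and "0 \<le> f 0" and "0 \<le> x"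
  shows "0 \<le> f x"
proof -
  have "f 0 \<le> f x"
    by (rule DERIV_nonneg_imp_nondecreasing) (use assms in auto)
  with assms(3) show ?thesis by simp
qed

lemma sinh_ge_self: "x \<le> sinh x" if "0 \<le> x" for x :: real
proof -
  have "0 \<le> sinh x - x"
    by (rule nonneg_if_deriv_nonneg[where f = "\<lambda>x. sinh x - x"
          and f' = "\<lambda>x. cosh x - 1"],
        (auto intro!: derivative_eq_intros simp: algebra_simps)[1])
       (use that in \<open>auto simp: cosh_real_ge_1\<close>)
  then show ?thesis by simp
qed

lemma sinh_le_self_mult_cosh: "sinh x \<le> x * cosh x" if "0 \<le> x" for x :: real
proof -
  have "0 \<le> x * cosh x - sinh x"
    by (rule nonneg_if_deriv_nonneg[where f = "\<lambda>x. x * cosh x - sinh x"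
          and f' = "\<lambda>x. x * sinh x"],
        (auto intro!: derivative_eq_intros simp: algebra_simps)[1])
       (use that in \<open>auto\<close>)
  then show ?thesis by simp
qed

lemma self_mult_cosh_minus_sinh_le: "3 * (x * cosh x - sinh x) \<le> x\<^sup>2 * sinh x" if "0 \<le> x" for x :: real
proof -
  have "0 \<le> x\<^sup>2 * sinh x - 3 * (x * cosh x - sinh x)"
    by (rule nonneg_if_deriv_nonneg[where f = "\<lambda>x. x\<^sup>2 * sinh x - 3 * (x * cosh x - sinh x)"
          and f' = "\<lambda>x. x * (x * cosh x - sinh x)"],
        (auto intro!: derivative_eq_intros simp: power2_eq_square algebra_simps)[1])
       (use that in \<open>auto simp: sinh_le_self_mult_cosh\<close>)
  then show ?thesis by simp
qed

text \<open>At \<open>x = 2 \<beta>\<close> this is the lower bound \<open>\<beta> / (\<beta> + 3) \<le> L(\<beta>)\<close> after multiplication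
  by \<open>\<beta> (\<beta> + 3) sinh \<beta>\<close> and \<open>2 exp \<beta>\<close>; doubling the argument leaves one exponential only.\<close>

lemma exp_ineq_for_langevin_ge: "0 \<le> x\<^sup>2 / 2 + 2 * x + 3 + (x - 3) * exp x" if "0 \<le> x" for x :: real
proof -
  have *: "0 \<le> 1 + (x - 1) * exp x" if "0 \<le> x" for x :: real
    by (rule nonneg_if_deriv_nonneg[where f = "\<lambda>x. 1 + (x - 1) * exp x"
          and f' = "\<lambda>x. x * exp x"],
        (auto intro!: derivative_eq_intros simp: algebra_simps)[1])
       (use that in \<open>auto simp: algebra_simps\<close>)
  have **: "0 \<le> x + 2 + (x - 2) * exp x" if "0 \<le> x" for x :: real
    by (rule nonneg_if_deriv_nonneg[where f = "\<lambda>x. x + 2 + (x - 2) * exp x"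
          and f' = "\<lambda>x. 1 + (x - 1) * exp x"],
        (auto intro!: derivative_eq_intros simp: algebra_simps)[1])
       (use that * in \<open>auto simp: algebra_simps\<close>)
  show ?thesis
    by (rule nonneg_if_deriv_nonneg[where f = "\<lambda>x. x\<^sup>2 / 2 + 2 * x + 3 + (x - 3) * exp x"
          and f' = "\<lambda>x. x + 2 + (x - 2) * exp x"],
        (auto intro!: derivative_eq_intros simp: algebra_simps)[1])
       (use that ** in \<open>auto simp: algebra_simps\<close>)
qed

text \<open>At \<open>x = 2 \<beta>\<close> this says that the derivative of \<open>L(\<beta>) / \<beta>\<close> is not positive.\<close>

lemma cosh_ineq_for_langevin_div: "4 * cosh x - 4 \<le> x * sinh x + x\<^sup>2" if "0 \<le> x" for x :: real
proof -
  have 1: "0 \<le> x * sinh x + 2 - 2 * cosh x" if "0 \<le> x" for x :: real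
    by (rule nonneg_if_deriv_nonneg[where f = "\<lambda>x. x * sinh x + 2 - 2 * cosh x"
          and f' = "\<lambda>x. x * cosh x - sinh x"],
        (auto intro!: derivative_eq_intros simp: algebra_simps)[1])
       (use that in \<open>auto simp: sinh_le_self_mult_cosh\<close>)
  have 2: "0 \<le> x * cosh x + 2 * x - 3 * sinh x" if "0 \<le> x" for x :: real
    by (rule nonneg_if_deriv_nonneg[where f = "\<lambda>x. x * cosh x + 2 * x - 3 * sinh x"
          and f' = "\<lambda>x. x * sinh x + 2 - 2 * cosh x"],
        (auto intro!: derivative_eq_intros simp: algebra_simps)[1])
       (use that 1 in \<open>auto\<close>)
  have "0 \<le> x * sinh x + x\<^sup>2 + 4 - 4 * cosh x"
    by (rule nonneg_if_deriv_nonneg[where f = "\<lambda>x. x * sinh x + x\<^sup>2 + 4 - 4 * cosh x"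
          and f' = "\<lambda>x. x * cosh x + 2 * x - 3 * sinh x"],
        (auto intro!: derivative_eq_intros simp: algebra_simps)[1])
       (use that 2 in \<open>auto\<close>)
  then show ?thesis by simp
qed

text \<open>At \<open>x = 2 \<beta>\<close> this says that the derivative of \<open>L(\<beta>) + L(\<beta>) / \<beta>\<close> is not negative. The
  Taylor expansion at \<open>0\<close> starts with \<open>x\<^sup>5 / 12\<close>, so four differentiations lose nothing.\<close>

lemma exp_cosh_ineq_for_langevin_add_div:
  "0 \<le> 2 * x * exp (- x) + 8 * cosh x - 8 - 2 * x - x ^ 3 - 2 * x\<^sup>2" if "0 \<le> x" for x :: real
proof -
  have 0: "0 \<le> 2 * x * exp (- x) - 8 * exp (- x) + 8 * cosh x" if "0 \<le> x" for x :: real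
  proof -
    have "exp (- x) \<le> exp x" using that by simp
    moreover have "0 \<le> x * exp (- x)" using that by simp
    ultimately have "0 \<le> 2 * (x * exp (- x)) + 4 * (exp x - exp (- x))" by simp
    then show ?thesis by (simp add: cosh_def algebra_simps)
  qed
  have 1: "0 \<le> (6 - 2 * x) * exp (- x) + 8 * sinh x - 6" if "0 \<le> x" for x :: real
    by (rule nonneg_if_deriv_nonneg[where f = "\<lambda>x. (6 - 2 * x) * exp (- x) + 8 * sinh x - 6"
          and f' = "\<lambda>x. 2 * x * exp (- x) - 8 * exp (- x) + 8 * cosh x"],
        (auto intro!: derivative_eq_intros simp: algebra_simps)[1])
       (use that 0 in \<open>auto simp: algebra_simps\<close>)
  have 2: "0 \<le> (2 * x - 4) * exp (- x) + 8 * cosh x - 6 * x - 4" if "0 \<le> x" for x :: real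
    by (rule nonneg_if_deriv_nonneg[where f = "\<lambda>x. (2 * x - 4) * exp (- x) + 8 * cosh x - 6 * x - 4"
          and f' = "\<lambda>x. (6 - 2 * x) * exp (- x) + 8 * sinh x - 6"],
        (auto intro!: derivative_eq_intros simp: algebra_simps)[1])
       (use that 1 in \<open>auto simp: algebra_simps\<close>)
  have 3: "0 \<le> (2 - 2 * x) * exp (- x) + 8 * sinh x - 2 - 3 * x\<^sup>2 - 4 * x" if "0 \<le> x" for x :: real
    by (rule nonneg_if_deriv_nonneg[where f = "\<lambda>x. (2 - 2 * x) * exp (- x) + 8 * sinh x - 2 - 3 * x\<^sup>2 - 4 * x"
          and f' = "\<lambda>x. (2 * x - 4) * exp (- x) + 8 * cosh x - 6 * x - 4"],
        (auto intro!: derivative_eq_intros simp: algebra_simps)[1])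
       (use that 2 in \<open>auto simp: algebra_simps\<close>)
  show ?thesis
    by (rule nonneg_if_deriv_nonneg[where f = "\<lambda>x. 2 * x * exp (- x) + 8 * cosh x - 8 - 2 * x - x ^ 3 - 2 * x\<^sup>2"
          and
          f' = "\<lambda>x. (2 - 2 * x) * exp (- x) + 8 * sinh x - 2 - 3 * x\<^sup>2 - 4 * x"],
        (auto intro!: derivative_eq_intros simp: algebra_simps)[1])
       (use that 3 in \<open>auto simp: algebra_simps\<close>)
qed

lemma sinh_gt_self: "x < sinh x" if "0 < x" for x :: real
proof -
  have "x < x * cosh (x / 2)"
    using that cosh_real_ge_1[of "x / 2"] cosh_real_one_iff[of "x / 2"]
    by (simp add: order_le_less)
  also have "\<dots> \<le> 2 * sinh (x / 2) * cosh (x / 2)"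
    using sinh_ge_self[of "x / 2"] that by (intro mult_right_mono) auto
  also have "\<dots> = sinh x"
    using sinh_double[of "x / 2"] by simp
  finally show ?thesis .
qed

section \<open>The Langevin function\<close>

lemma langevin_quotient:
  "langevin \<beta> = (\<beta> * cosh \<beta> - sinh \<beta>) / (\<beta> * sinh \<beta>)" if "0 < \<beta>"
  using that by (simp add: langevin_def field_simps)

lemma langevin_le: "langevin \<beta> \<le> \<beta> / 3" if "0 < \<beta>"
  using self_mult_cosh_minus_sinh_le[of \<beta>] that
  by (simp add: langevin_quotient divide_le_eq power2_eq_square algebra_simps)

text \<open>Besides the bound \<open>\<rho>(h) \<le> h\<close>, this estimate supplies the surjectivity of \<open>L\<close> onto the
  unit interval: \<open>\<beta> / (\<beta> + 3)\<close> can be solved for \<open>\<beta>\<close>.\<close>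

lemma langevin_ge: "\<beta> / (\<beta> + 3) \<le> langevin \<beta>" if "0 < \<beta>"
proof -
  define e where "e = exp \<beta>"
  have e: "e > 0" by (simp add: e_def)
  have ee: "exp (2 * \<beta>) = e\<^sup>2" by (simp add: e_def exp_double)
  have c: "cosh \<beta> = (e + 1 / e) / 2" and s: "sinh \<beta> = (e - 1 / e) / 2"
    by (simp_all add: cosh_def sinh_def e_def exp_minus field_simps)
  have "0 \<le> 2 * \<beta>\<^sup>2 + 4 * \<beta> + 3 + (2 * \<beta> - 3) * e\<^sup>2"
    using exp_ineq_for_langevin_ge[of "2 * \<beta>"] that by (simp add: ee power_mult_distrib)
  then have "0 \<le> (2 * \<beta>\<^sup>2 + 4 * \<beta> + 3 + (2 * \<beta> - 3) * e\<^sup>2) / (2 * e)"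
    using e by simp
  also have "\<dots> = (\<beta> * cosh \<beta> - sinh \<beta>) * (\<beta> + 3) - \<beta> * (\<beta> * sinh \<beta>)"
    using e unfolding c s by (simp add: field_simps power2_eq_square)
  finally have "\<beta> * (\<beta> * sinh \<beta>) \<le> (\<beta> * cosh \<beta> - sinh \<beta>) * (\<beta> + 3)" by simp
  then show ?thesis
    using that by (simp add: langevin_quotient frac_le_eq divide_le_eq le_divide_eq field_simps)
qed

text \<open>Equivalent to \<open>2 \<beta> + 2 \<beta>\<^sup>2 \<le> exp (2 \<beta>) - 1\<close>. It is the slope bound for \<open>\<rho>\<close> between an
  interior point and the endpoint \<open>h = 1\<close>.\<close>

lemma langevin_add_div_le_1: "langevin \<beta> + langevin \<beta> / \<beta> \<le> 1" if "0 < \<beta>"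
proof -
  define e where "e = exp \<beta>"
  have e: "e > 0" by (simp add: e_def)
  have ee: "exp (2 * \<beta>) = e\<^sup>2" by (simp add: e_def exp_double)
  have c: "cosh \<beta> = (e + 1 / e) / 2" and s: "sinh \<beta> = (e - 1 / e) / 2"
    by (simp_all add: cosh_def sinh_def e_def exp_minus field_simps)
  have "0 \<le> e\<^sup>2 - 1 - 2 * \<beta> - 2 * \<beta>\<^sup>2"
    using exp_lower_Taylor_quadratic[of "2 * \<beta>"] that by (simp add: ee power_mult_distrib)
  then have "0 \<le> (e\<^sup>2 - 1 - 2 * \<beta> - 2 * \<beta>\<^sup>2) / (2 * e)"
    using e by simp
  also have "\<dots> = \<beta> * (\<beta> * sinh \<beta>) - (\<beta> * cosh \<beta> - sinh \<beta>) * (\<beta> + 1)"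
    using e unfolding c s by (simp add: field_simps power2_eq_square)
  finally have *: "(\<beta> * cosh \<beta> - sinh \<beta>) * (\<beta> + 1) \<le> \<beta> * (\<beta> * sinh \<beta>)" by simp
  have "langevin \<beta> + langevin \<beta> / \<beta> = ((\<beta> * cosh \<beta> - sinh \<beta>) * (\<beta> + 1)) / (\<beta> * (\<beta> * sinh \<beta>))"
    using that by (simp add: langevin_quotient field_simps)
  also have "\<dots> \<le> 1"
    using * that by (simp add: divide_le_eq)
  finally show ?thesis .
qed

lemma has_real_derivative_langevin:
  "(langevin has_real_derivative 1 / \<beta>\<^sup>2 - 1 / (sinh \<beta>)\<^sup>2) (at \<beta>)" if "0 < \<beta>"
proof -
  have "((\<lambda>\<beta>. cosh \<beta> / sinh \<beta> - 1 / \<beta>) has_real_derivative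
      (sinh \<beta> * sinh \<beta> - cosh \<beta> * cosh \<beta>) / (sinh \<beta> * sinh \<beta>) - - 1 / (\<beta> * \<beta>)) (at \<beta>)"
    using that by (auto intro!: derivative_eq_intros)
  moreover have "sinh \<beta> * sinh \<beta> - cosh \<beta> * cosh \<beta> = - 1"
    using cosh_square_eq[of \<beta>] by (simp add: power2_eq_square)
  ultimately show ?thesis
    by (simp add: langevin_def[abs_def] power2_eq_square)
qed

lemma langevin_deriv_pos: "0 < 1 / \<beta>\<^sup>2 - 1 / (sinh \<beta>)\<^sup>2" if "0 < \<beta>" for \<beta> :: real
proof -
  have "\<beta>\<^sup>2 < (sinh \<beta>)\<^sup>2"
    using sinh_gt_self[OF that] that by (intro power_strict_mono) auto
  then show ?thesis using that by (simp add: frac_less2)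
qed

lemma langevin_less: "langevin \<beta> < langevin \<gamma>" if "0 < \<beta>" "\<beta> < \<gamma>"
  by (rule DERIV_pos_imp_increasing[OF that(2)])
     (use that has_real_derivative_langevin langevin_deriv_pos in \<open>meson less_le_trans\<close>)

text \<open>Together with \<open>L' > 0\<close> this Riccati equation gives \<open>h\<^sup>2 \<le> \<psi>(h)\<close>: its left-hand side
  is \<open>\<psi> - h\<^sup>2\<close>, the variance of the underlying angular distribution along its axis, and its
  right-hand side is \<open>L'\<close>.\<close>

lemma langevin_riccati:
  "1 - 2 * langevin \<beta> / \<beta> - (langevin \<beta>)\<^sup>2 = 1 / \<beta>\<^sup>2 - 1 / (sinh \<beta>)\<^sup>2" if "0 < \<beta>"
proof -
  define c s where "c = cosh \<beta>" and "s = sinh \<beta>"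
  have "c\<^sup>2 = s\<^sup>2 + 1" "s \<noteq> 0" using that by (auto simp: c_def s_def cosh_square_eq)
  moreover have "langevin \<beta> = c / s - 1 / \<beta>" by (simp add: langevin_def c_def s_def)
  ultimately show ?thesis
    using that unfolding s_def[symmetric] by (simp add: field_simps power2_eq_square; algebra)
qed

text \<open>Since \<open>\<rho> = 1 - 3 L(\<beta>) / \<beta>\<close>, this is the monotonicity of \<open>\<rho>\<close>.\<close>

lemma langevin_div_antimono: "langevin \<gamma> / \<gamma> \<le> langevin \<beta> / \<beta>" if "0 < \<beta>" "\<beta> \<le> \<gamma>"
proof (rule DERIV_nonpos_imp_nonincreasing[OF that(2), where f = "\<lambda>x. langevin x / x"])
  fix x assume "\<beta> \<le> x" "x \<le> \<gamma>"
  with that have x: "x > 0" by simp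
  define c s where "c = cosh x" and "s = sinh x"
  have s: "s > 0" using x by (simp add: s_def)
  have "4 * cosh (2 * x) - 4 \<le> 2 * x * sinh (2 * x) + (2 * x)\<^sup>2"
    using cosh_ineq_for_langevin_div[of "2 * x"] x by simp
  then have *: "2 * s\<^sup>2 \<le> x * s * c + x\<^sup>2"
    by (simp add: c_def s_def cosh_double cosh_square_eq sinh_double power_mult_distrib)
  have "((\<lambda>x. langevin x / x) has_real_derivative
      ((1 / x\<^sup>2 - 1 / s\<^sup>2) * x - langevin x) / (x * x)) (at x)"
    using x by (auto intro!: derivative_eq_intros has_real_derivative_langevin simp: s_def)
  moreover have "langevin x = c / s - 1 / x"
    by (simp add: langevin_def c_def s_def)
  moreover have "(1 / x\<^sup>2 - 1 / s\<^sup>2) * x - (c / s - 1 / x) = (2 * s\<^sup>2 - x * s * c - x\<^sup>2) / (x * s\<^sup>2)"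
    using x s by (simp add: field_simps power2_eq_square)
  ultimately show "\<exists>y. ((\<lambda>x. langevin x / x) has_real_derivative y) (at x) \<and> y \<le> 0"
    using * x s by (auto intro!: exI divide_nonpos_pos)
qed

text \<open>The slope bound \<open>\<rho>(k) - \<rho>(h) \<le> 3 (k - h)\<close> means that \<open>3 h - \<rho>(h)\<close> increases, and
  this is \<open>3 (L + L / \<beta>) - 1\<close>.\<close>

lemma langevin_add_div_mono:
  "langevin \<beta> + langevin \<beta> / \<beta> \<le> langevin \<gamma> + langevin \<gamma> / \<gamma>" if "0 < \<beta>" "\<beta> \<le> \<gamma>"
proof (rule DERIV_nonneg_imp_nondecreasing[OF that(2), where f = "\<lambda>x. langevin x + langevin x / x"])
  fix x assume "\<beta> \<le> x" "x \<le> \<gamma>"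
  with that have x: "x > 0" by simp
  define c s where "c = cosh x" and "s = sinh x"
  have s: "s > 0" using x by (simp add: s_def)
  have cs: "c\<^sup>2 = s\<^sup>2 + 1" by (simp add: c_def s_def cosh_square_eq)
  have "exp (- (2 * x)) = cosh (2 * x) - sinh (2 * x)" by (simp add: cosh_minus_sinh)
  then have e: "exp (- (2 * x)) = 2 * s\<^sup>2 + 1 - 2 * s * c"
    by (simp add: c_def s_def cosh_double cosh_square_eq sinh_double)
  have "cosh (2 * x) = 2 * s\<^sup>2 + 1" by (simp add: s_def cosh_double cosh_square_eq)
  with exp_cosh_ineq_for_langevin_add_div[of "2 * x"] x
  have *: "0 \<le> 2 * (2 * x) * (2 * s\<^sup>2 + 1 - 2 * s * c) + 8 * (2 * s\<^sup>2 + 1) - 8 - 2 * (2 * x)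
      - (2 * x) ^ 3 - 2 * (2 * x)\<^sup>2"
    unfolding e[symmetric] by simp
  have **: "0 \<le> (x + 2) * s\<^sup>2 - x ^ 3 - x\<^sup>2 - x * s * c"
    using * by (simp add: algebra_simps power2_eq_square power3_eq_cube)
  have "((\<lambda>x. langevin x + langevin x / x) has_real_derivative
      (1 / x\<^sup>2 - 1 / s\<^sup>2) + ((1 / x\<^sup>2 - 1 / s\<^sup>2) * x - langevin x) / (x * x)) (at x)"
    using x by (auto intro!: derivative_eq_intros has_real_derivative_langevin simp: s_def)
  moreover have "langevin x = c / s - 1 / x"
    by (simp add: langevin_def c_def s_def)
  moreover have "(1 / x\<^sup>2 - 1 / s\<^sup>2) + ((1 / x\<^sup>2 - 1 / s\<^sup>2) * x - (c / s - 1 / x)) / (x * x)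
      = ((x + 2) * s\<^sup>2 - x ^ 3 - x\<^sup>2 - x * s * c) / (x ^ 3 * s\<^sup>2)"
    using x s by (simp add: field_simps power2_eq_square power3_eq_cube)
  ultimately show "\<exists>y. ((\<lambda>x. langevin x + langevin x / x) has_real_derivative y) (at x) \<and> 0 \<le> y"
    using ** x s by (auto intro!: exI divide_nonneg_pos)
qed

text \<open>The intermediate value theorem applies on \<open>[h, 3 h / (1 - h)]\<close>: at the left end
  \<open>L(h) \<le> h / 3\<close>, and at the right end the lower bound \<open>\<beta> / (\<beta> + 3)\<close> equals \<open>h\<close>.\<close>

lemma langevin_inv_works:
  assumes "0 < h" "h < 1"
  shows "0 < langevin_inv h" "langevin (langevin_inv h) = h"
proof -
  define b where "b = 3 * h / (1 - h)"
  have b: "h \<le> b" and "b / (b + 3) = h" using assms by (auto simp: b_def field_simps)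
  then have hi: "h \<le> langevin b" using langevin_ge[of b] assms by simp
  have lo: "langevin h \<le> h" using langevin_le[of h] assms by simp
  have "continuous_on {h..b} langevin"
    using assms DERIV_isCont[OF has_real_derivative_langevin]
    by (intro continuous_at_imp_continuous_on) auto
  then obtain \<beta> where "h \<le> \<beta>" "langevin \<beta> = h"
    using IVT'[of langevin h h b, OF lo hi b] by auto
  then have "h \<in> langevin ` {0<..}" using assms by force
  moreover have inj: "inj_on langevin {0<..}"
    by (auto intro!: linorder_inj_onI' dest: langevin_less)
  ultimately show "0 < langevin_inv h" "langevin (langevin_inv h) = h"
    unfolding langevin_inv_def
    using the_inv_into_into[OF inj, of h "{0<..}"] f_the_inv_into_f[OF inj] by auto
qed

lemma langevin_inv_mono: "langevin_inv h \<le> langevin_inv k" if "0 < h" "h \<le> k" "k < 1"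
  using langevin_less[of "langevin_inv k" "langevin_inv h"] langevin_inv_works[of h]
    langevin_inv_works[of k] that by force

section \<open>The shape of the Eddington factor\<close>

text \<open>The coefficient of the traceless part \<open>n n\<^sup>T - 1/3\<close> of the closure tensor: \<open>0\<close> for an
  isotropic state, \<open>1\<close> for a state concentrated in one direction.\<close>

definition anisotropy :: "real \<Rightarrow> real" where
  "anisotropy h = (3 * eddington h - 1) / 2"

lemma anisotropy_0 [simp]: "anisotropy 0 = 0" and anisotropy_1 [simp]: "anisotropy 1 = 1"
  by (simp_all add: anisotropy_def eddington_def)

lemma anisotropy_eq: "anisotropy h = 1 - 3 * (h / langevin_inv h)" if "0 < h" "h < 1"
  using that by (simp add: anisotropy_def eddington_def field_simps)

lemma anisotropy_nonneg: "0 \<le> anisotropy h" if "0 \<le> h" "h \<le> 1"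
proof -
  have "h / langevin_inv h \<le> 1 / 3" if "0 < h" "h < 1"
    using langevin_le[of "langevin_inv h"] langevin_inv_works[OF that]
    by (simp add: divide_le_eq)
  with that show ?thesis
    by (cases "h = 0 \<or> h = 1") (auto simp: anisotropy_eq mult.commute)
qed

lemma anisotropy_le: "anisotropy h \<le> h" if "0 \<le> h" "h \<le> 1"
proof -
  have "1 - 3 * (h / langevin_inv h) \<le> h" if "0 < h" "h < 1"
  proof -
    define \<beta> where "\<beta> = langevin_inv h"
    have \<beta>: "0 < \<beta>" "langevin \<beta> = h"
      using langevin_inv_works[OF that] by (simp_all add: \<beta>_def)
    have "\<beta> \<le> h * (\<beta> + 3)"
      using langevin_ge[OF \<beta>(1)] \<beta> by (simp add: divide_le_eq)
    then show ?thesis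
      unfolding \<beta>_def[symmetric] using \<beta>(1) by (simp add: field_simps)
  qed
  with that show ?thesis
    by (cases "h = 0 \<or> h = 1") (auto simp: anisotropy_eq)
qed

lemma anisotropy_le_1: "anisotropy h \<le> 1" if "0 \<le> h" "h \<le> 1"
  using anisotropy_le[OF that] that by simp

lemma anisotropy_mono: "anisotropy h \<le> anisotropy k" if hk: "0 \<le> h" "h \<le> k" "k \<le> 1"
proof -
  consider "h = 0" | "k = 1" | "0 < h" "k < 1" using hk by linarith
  then show ?thesis
  proof cases
    case 3
    then show ?thesis
      using langevin_div_antimono[of "langevin_inv h" "langevin_inv k"] hk
        langevin_inv_works[of h] langevin_inv_works[of k] langevin_inv_mono[of h k]
      by (simp add: anisotropy_eq)
  qed (use hk in \<open>auto simp: anisotropy_nonneg anisotropy_le_1\<close>)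
qed

text \<open>The slope \<open>3\<close> is the limiting slope of \<open>\<rho>\<close> at \<open>h = 1\<close>. The endpoints are treated
  separately because there \<open>\<rho>\<close> is given by its prescribed values and not through \<open>L\<close>.\<close>

lemma anisotropy_diff_le: "anisotropy k - anisotropy h \<le> 3 * (k - h)"
  if hk: "0 \<le> h" "h \<le> k" "k \<le> 1"
proof -
  consider "h = 0" | "k = h" | "0 < h" "h < 1" "k = 1" | "0 < h" "k < 1" using hk by linarith
  then show ?thesis
  proof cases
    case 1
    then show ?thesis using anisotropy_le[of k] hk by simp
  next
    case 3
    then show ?thesis
      using langevin_add_div_le_1[of "langevin_inv h"] langevin_inv_works[of h]
      by (simp add: anisotropy_eq)
  next
    case 4
    then show ?thesis
      using langevin_add_div_mono[of "langevin_inv h" "langevin_inv k"] hk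
        langevin_inv_works[of h] langevin_inv_works[of k] langevin_inv_mono[of h k]
      by (simp add: anisotropy_eq)
  qed simp
qed

lemma anisotropy_ge_square: "3 * h\<^sup>2 \<le> 1 + 2 * anisotropy h" if "0 \<le> h" "h \<le> 1"
proof -
  have "h\<^sup>2 \<le> 1 - 2 * (h / langevin_inv h)" if "0 < h" "h < 1"
    using langevin_riccati[of "langevin_inv h"] langevin_deriv_pos[of "langevin_inv h"]
      langevin_inv_works[OF that] by simp
  with that show ?thesis
    by (cases "h = 0 \<or> h = 1") (auto simp: anisotropy_eq)
qed

section \<open>The pressure of a moment state\<close>

definition pressure :: "real \<times> (real ^ 3) \<Rightarrow> real ^ 3 \<Rightarrow> real ^ 3" where
  "pressure M v = fst M *\<^sub>R (v v* closure_tensor M)"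

lemma pressure_eq:
  "pressure (D, I) v = (D / 3) *\<^sub>R v +
     (D * anisotropy (norm I / D)) *\<^sub>R ((sgn I \<bullet> v) *\<^sub>R sgn I - (1 / 3) *\<^sub>R v)"
proof -
  have "(v v* closure_tensor (D, I)) $ j = v $ j / 3 +
      anisotropy (norm I / D) * ((sgn I \<bullet> v) * sgn I $ j - v $ j / 3)" for j
  proof -
    define \<psi> where "\<psi> = eddington (norm I / D)"
    have "(v v* closure_tensor (D, I)) $ j =
       (\<Sum>i\<in>UNIV. v $ i * (1/2 * ((1 - \<psi>) * (if i = j then 1 else 0)
          + (3 * \<psi> - 1) * (sgn I $ i * sgn I $ j))))"
      by (simp add: vector_matrix_mult_def closure_tensor_def flux_factor_def \<psi>_def Let_def mult_ac)
    also have "\<dots> = (\<Sum>i\<in>UNIV. 1/2 * (1 - \<psi>) * (if i = j then v $ i else 0))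
          + (\<Sum>i\<in>UNIV. 1/2 * (3 * \<psi> - 1) * sgn I $ j * (sgn I $ i * v $ i))"
      unfolding sum.distrib[symmetric] by (intro sum.cong) (auto simp: field_simps)
    also have "\<dots> = 1/2 * (1 - \<psi>) * v $ j + 1/2 * (3 * \<psi> - 1) * sgn I $ j * (sgn I \<bullet> v)"
      unfolding sum_distrib_left[symmetric] by (simp add: inner_vec_def)
    also have "\<dots> = v $ j / 3 + (3 * \<psi> - 1) / 2 * ((sgn I \<bullet> v) * sgn I $ j - v $ j / 3)"
      by (simp add: field_simps)
    finally show ?thesis
      by (simp add: anisotropy_def \<psi>_def)
  qed
  then have "v v* closure_tensor (D, I) = (1 / 3) *\<^sub>R v +
      anisotropy (norm I / D) *\<^sub>R ((sgn I \<bullet> v) *\<^sub>R sgn I - (1 / 3) *\<^sub>R v)"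
    by (simp add: vec_eq_iff)
  then show ?thesis
    by (simp add: pressure_def scaleR_add_right)
qed

text \<open>For \<open>I = 0\<close> the traceless part vanishes, so any unit vector serves as its direction. This
  removes the case \<open>sgn I = 0\<close> from all later computations.\<close>

lemma pressure_direction:
  obtains n where "norm n = 1" "I = norm I *\<^sub>R n"
    "\<And>v. pressure (D, I) v =
       (D / 3) *\<^sub>R v + (D * anisotropy (norm I / D)) *\<^sub>R ((n \<bullet> v) *\<^sub>R n - (1 / 3) *\<^sub>R v)"
proof (cases "I = 0")
  case True
  obtain n :: "real ^ 3" where "norm n = 1"
    using vector_choose_size[of 1] by auto
  then show ?thesis
    by (intro that) (simp_all add: pressure_eq True)
next
  case False
  show ?thesis
    by (rule that[of "sgn I"]) (use False in \<open>simp_all add: pressure_eq norm_sgn, simp add: sgn_div_norm\<close>)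
qed

section \<open>Lipschitz continuity of the pressure\<close>

text \<open>The difference of the projections onto \<open>n\<close> and \<open>m\<close> has norm \<open>sin \<theta>\<close>, where \<open>\<theta>\<close> is the angle
  between them, and \<open>sin \<theta> \<le> |n - m|\<close>. Without angles: \<open>p = n - m\<close> and \<open>q = n + m\<close> are
  orthogonal, the difference is \<open>((q \<bullet> v) p + (p \<bullet> v) q) / 2\<close>, and Bessel's inequality
  for \<open>p, q\<close> bounds it. The triangle inequality would lose a factor \<open>2\<close>.\<close>

lemma norm_projection_diff_le:
  fixes n m v :: "'a :: real_inner"
  assumes "norm n = 1" "norm m = 1"
  shows "norm ((n \<bullet> v) *\<^sub>R n - (m \<bullet> v) *\<^sub>R m) \<le> norm (n - m) * norm v"
proof -
  define p q where "p = n - m" and "q = n + m"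
  define P Q V x y where "P = p \<bullet> p" and "Q = q \<bullet> q" and "V = v \<bullet> v" and "x = q \<bullet> v" and "y = p \<bullet> v"
  have unit: "n \<bullet> n = 1" "m \<bullet> m = 1" using assms by (simp_all add: norm_eq_1)
  have pq: "p \<bullet> q = 0" "q \<bullet> p = 0"
    using unit by (simp_all add: p_def q_def algebra_simps inner_commute)
  have nn: "P \<ge> 0" "Q \<ge> 0" "V \<ge> 0" by (simp_all add: P_def Q_def V_def)
  have "P + Q = 4"
    using unit by (simp add: P_def Q_def p_def q_def algebra_simps inner_commute)
  with nn have "Q \<le> 4" by simp
  have bessel: "P * x\<^sup>2 + Q * y\<^sup>2 \<le> P * Q * V"
  proof (cases "p = 0 \<or> q = 0")
    case True
    then show ?thesis by (auto simp: P_def Q_def x_def y_def)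
  next
    case False
    then have pos: "P * Q > 0" by (simp add: P_def Q_def)
    \<comment> \<open>The residual of the projection onto the span of \<open>p\<close> and \<open>q\<close>, scaled by \<open>P Q\<close>.\<close>
    have "0 \<le> (norm ((P * Q) *\<^sub>R v - (P * x) *\<^sub>R q - (Q * y) *\<^sub>R p))\<^sup>2" by simp
    also have "\<dots> = P * Q * (P * Q * V - P * x\<^sup>2 - Q * y\<^sup>2)"
      unfolding power2_norm_eq_inner
      by (simp add: inner_diff_left inner_diff_right pq inner_commute[of v p]
          inner_commute[of v q] flip: P_def Q_def V_def x_def y_def)
         (simp add: algebra_simps power2_eq_square)
    finally show ?thesis using pos by (simp add: zero_le_mult_iff)
  qed
  have "(n \<bullet> v) *\<^sub>R n - (m \<bullet> v) *\<^sub>R m = (1/2) *\<^sub>R (x *\<^sub>R p + y *\<^sub>R q)"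
  proof -
    have "x *\<^sub>R p + y *\<^sub>R q =
        ((n \<bullet> v) *\<^sub>R n - (m \<bullet> v) *\<^sub>R m) + ((n \<bullet> v) *\<^sub>R n - (m \<bullet> v) *\<^sub>R m)"
      by (simp add: x_def y_def p_def q_def inner_add_left inner_diff_left algebra_simps)
    then show ?thesis by (simp flip: scaleR_2)
  qed
  then have "(norm ((n \<bullet> v) *\<^sub>R n - (m \<bullet> v) *\<^sub>R m))\<^sup>2 = (P * x\<^sup>2 + Q * y\<^sup>2) / 4"
    by (simp add: power_mult_distrib power2_norm_eq_inner inner_add_left inner_add_right pq power_divide
       flip: P_def Q_def) (simp add: power2_eq_square algebra_simps)
  also have "\<dots> \<le> P * V"
    using bessel mult_left_mono[OF \<open>Q \<le> 4\<close>, of "P * V"] nn by (simp add: algebra_simps)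
  also have "\<dots> = (norm (n - m) * norm v)\<^sup>2"
    by (simp add: P_def V_def p_def power_mult_distrib power2_norm_eq_inner)
  finally show ?thesis by (rule power2_le_imp_le) simp
qed

text \<open>With the reflections \<open>R = 2 n n\<^sup>T - 1\<close> and \<open>S = 2 m m\<^sup>T - 1\<close> the difference is
  \<open>(\<rho> R - \<sigma> S) v / 2 + (\<rho> - \<sigma>) v / 6\<close>. As \<open>R v\<close> and \<open>S v\<close> have the length of \<open>v\<close>, the norm of
  the first part splits into a radial part \<open>(\<rho> - \<sigma>)\<^sup>2\<close> and an angular part
  \<open>\<rho> \<sigma> |R v - S v|\<^sup>2\<close>, in the same way as \<open>|r n - s m|\<^sup>2 = (r - s)\<^sup>2 + r s |n - m|\<^sup>2\<close>.
  Comparing part by part gives the constant \<open>2\<close>; separate estimates of radial and angular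
  changes would not.\<close>

lemma norm_deviator_diff_le:
  fixes n m v :: "'a :: real_inner"
  assumes unit: "norm n = 1" "norm m = 1"
    and \<rho>: "0 \<le> \<rho>" "\<rho> \<le> r" and \<sigma>: "0 \<le> \<sigma>" "\<sigma> \<le> s" and slope: "\<bar>\<rho> - \<sigma>\<bar> \<le> 3 * \<bar>r - s\<bar>"
  shows "norm (\<rho> *\<^sub>R ((n \<bullet> v) *\<^sub>R n - (1 / 3) *\<^sub>R v) - \<sigma> *\<^sub>R ((m \<bullet> v) *\<^sub>R m - (1 / 3) *\<^sub>R v))
    \<le> 2 * norm (r *\<^sub>R n - s *\<^sub>R m) * norm v"
proof -
  define R S where "R = 2 *\<^sub>R ((n \<bullet> v) *\<^sub>R n) - v" and "S = 2 *\<^sub>R ((m \<bullet> v) *\<^sub>R m) - v"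
  define a d w where "a = \<bar>r - s\<bar>" and "d = norm (r *\<^sub>R n - s *\<^sub>R m)" and "w = (norm (n - m))\<^sup>2"
  have combine: "(norm (\<rho> *\<^sub>R x - \<sigma> *\<^sub>R y))\<^sup>2 = (\<rho> - \<sigma>)\<^sup>2 * c\<^sup>2 + \<rho> * \<sigma> * (norm (x - y))\<^sup>2"
    if "norm x = c" "norm y = c" for x y :: 'a and \<rho> \<sigma> c :: real
  proof -
    have "x \<bullet> x = c\<^sup>2" "y \<bullet> y = c\<^sup>2" using that by (simp_all add: dot_square_norm)
    then show ?thesis
      unfolding power2_norm_eq_inner
      by (simp add: inner_diff_left inner_diff_right inner_commute algebra_simps power2_eq_square)
  qed
  have nu: "n \<bullet> n = 1" "m \<bullet> m = 1" using unit by (simp_all add: norm_eq_1)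
  have "norm R = norm v" "norm S = norm v"
    by (simp_all add: R_def S_def norm_eq_sqrt_inner inner_diff_left inner_diff_right nu inner_commute)
  note RS = combine[OF this]
  have d2: "d\<^sup>2 = a\<^sup>2 + r * s * w"
    using combine[OF unit] by (simp add: d_def a_def w_def)
  have "w \<ge> 0" "a \<ge> 0" "d \<ge> 0" by (simp_all add: w_def a_def d_def)
  have "r * s * w \<ge> 0" using \<rho> \<sigma> \<open>w \<ge> 0\<close> by simp
  with d2 \<open>d \<ge> 0\<close> have "a\<^sup>2 \<le> d\<^sup>2" by simp
  then have "a \<le> d" using \<open>d \<ge> 0\<close> by (rule power2_le_imp_le)
  have "norm (R - S) = 2 * norm ((n \<bullet> v) *\<^sub>R n - (m \<bullet> v) *\<^sub>R m)"
    unfolding R_def S_def by (simp add: scaleR_diff_right[symmetric] del: scaleR_scaleR)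
  also have "\<dots> \<le> 2 * (norm (n - m) * norm v)"
    using norm_projection_diff_le[OF unit] by simp
  finally have "(norm (R - S))\<^sup>2 \<le> (2 * (norm (n - m) * norm v))\<^sup>2"
    by (intro power_mono) auto
  then have RS2: "(norm (R - S))\<^sup>2 \<le> 4 * w * (norm v)\<^sup>2"
    by (simp add: w_def power_mult_distrib)
  have "\<rho> * \<sigma> * (norm (R - S))\<^sup>2 \<le> (r * s) * (4 * w * (norm v)\<^sup>2)"
    using \<rho> \<sigma> RS2 by (intro mult_mono) auto
  moreover have "(\<rho> - \<sigma>)\<^sup>2 \<le> (3 * a)\<^sup>2"
    using slope unfolding abs_le_square_iff[symmetric] by (simp add: a_def)
  then have "(\<rho> - \<sigma>)\<^sup>2 * (norm v)\<^sup>2 \<le> (3 * a)\<^sup>2 * (norm v)\<^sup>2"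
    by (rule mult_right_mono) simp
  ultimately have "(norm (\<rho> *\<^sub>R R - \<sigma> *\<^sub>R S))\<^sup>2 \<le> (9 * a\<^sup>2 + 4 * (r * s * w)) * (norm v)\<^sup>2"
    unfolding RS by (simp add: algebra_simps)
  also have "\<dots> \<le> (4 * d - a)\<^sup>2 * (norm v)\<^sup>2"
  proof (rule mult_right_mono)
    \<comment> \<open>The difference of the two sides is this product, since \<open>d\<^sup>2 = a\<^sup>2 + r s w\<close>.\<close>
    have "0 \<le> 4 * ((d - a) * (3 * d + a))"
      using \<open>a \<le> d\<close> \<open>a \<ge> 0\<close> by simp
    then show "9 * a\<^sup>2 + 4 * (r * s * w) \<le> (4 * d - a)\<^sup>2"
      using d2 by (simp add: algebra_simps power2_eq_square)
  qed simp
  finally have "(norm (\<rho> *\<^sub>R R - \<sigma> *\<^sub>R S))\<^sup>2 \<le> ((4 * d - a) * norm v)\<^sup>2"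
    by (simp add: power_mult_distrib)
  then have X: "norm (\<rho> *\<^sub>R R - \<sigma> *\<^sub>R S) \<le> (4 * d - a) * norm v"
    by (rule power2_le_imp_le) (use \<open>a \<le> d\<close> \<open>a \<ge> 0\<close> in simp)
  have "\<rho> *\<^sub>R ((n \<bullet> v) *\<^sub>R n - (1 / 3) *\<^sub>R v) - \<sigma> *\<^sub>R ((m \<bullet> v) *\<^sub>R m - (1 / 3) *\<^sub>R v)
    = (1 / 2) *\<^sub>R (\<rho> *\<^sub>R R - \<sigma> *\<^sub>R S) + ((\<rho> - \<sigma>) / 6) *\<^sub>R v"
  proof -
    have "(1 / 2) *\<^sub>R (\<rho> *\<^sub>R R) = \<rho> *\<^sub>R ((n \<bullet> v) *\<^sub>R n) - (\<rho> / 2) *\<^sub>R v"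
         "(1 / 2) *\<^sub>R (\<sigma> *\<^sub>R S) = \<sigma> *\<^sub>R ((m \<bullet> v) *\<^sub>R m) - (\<sigma> / 2) *\<^sub>R v"
      by (simp_all add: R_def S_def scaleR_diff_right)
    moreover have "(c / 2) *\<^sub>R v = (c / 3) *\<^sub>R v + (c / 6) *\<^sub>R v" for c
      by (simp flip: scaleR_add_left)
    ultimately show ?thesis
      by (simp add: scaleR_diff_right diff_divide_distrib scaleR_diff_left)
  qed
  also have "norm \<dots> \<le> (1 / 2) * ((4 * d - a) * norm v) + (3 * a / 6) * norm v"
  proof (rule order_trans[OF norm_triangle_ineq add_mono])
    show "norm ((1 / 2) *\<^sub>R (\<rho> *\<^sub>R R - \<sigma> *\<^sub>R S)) \<le> (1 / 2) * ((4 * d - a) * norm v)"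
      using X by simp
    show "norm (((\<rho> - \<sigma>) / 6) *\<^sub>R v) \<le> (3 * a / 6) * norm v"
      unfolding norm_scaleR using slope by (intro mult_right_mono) (auto simp: a_def)
  qed
  also have "\<dots> = 2 * d * norm v" by (simp add: algebra_simps)
  finally show ?thesis unfolding d_def .
qed

lemma pressure_flux_lipschitz:
  assumes "norm I \<le> D" "norm J \<le> D"
  shows "norm (pressure (D, I) v - pressure (D, J) v) \<le> 2 * norm (I - J) * norm v"
proof (cases "D = 0")
  case True
  then show ?thesis by (simp add: pressure_def)
next
  case False
  with assms have D: "D > 0" by (smt (verit) norm_ge_zero)
  obtain n where n: "norm n = 1" "I = norm I *\<^sub>R n" "\<And>v. pressure (D, I) v =
       (D / 3) *\<^sub>R v + (D * anisotropy (norm I / D)) *\<^sub>R ((n \<bullet> v) *\<^sub>R n - (1 / 3) *\<^sub>R v)"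
    using pressure_direction[where I = I and D = D] by blast
  obtain m where m: "norm m = 1" "J = norm J *\<^sub>R m" "\<And>v. pressure (D, J) v =
       (D / 3) *\<^sub>R v + (D * anisotropy (norm J / D)) *\<^sub>R ((m \<bullet> v) *\<^sub>R m - (1 / 3) *\<^sub>R v)"
    using pressure_direction[where I = J and D = D] by blast
  define \<rho> \<sigma> where "\<rho> = D * anisotropy (norm I / D)" and "\<sigma> = D * anisotropy (norm J / D)"
  have h: "0 \<le> norm I / D" "norm I / D \<le> 1" "0 \<le> norm J / D" "norm J / D \<le> 1"
    using assms D by auto
  have bounds: "0 \<le> \<rho>" "\<rho> \<le> norm I" "0 \<le> \<sigma>" "\<sigma> \<le> norm J"
    using anisotropy_nonneg[OF h(1,2)] anisotropy_le[OF h(1,2)]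
      anisotropy_nonneg[OF h(3,4)] anisotropy_le[OF h(3,4)] D
    by (simp_all add: \<rho>_def \<sigma>_def le_divide_eq mult.commute)
  have slope: "\<bar>D * anisotropy h - D * anisotropy k\<bar> \<le> 3 * \<bar>D * h - D * k\<bar>"
    if "0 \<le> h" "h \<le> 1" "0 \<le> k" "k \<le> 1" for h k
  proof -
    have "\<bar>anisotropy h - anisotropy k\<bar> \<le> 3 * \<bar>h - k\<bar>"
      using that anisotropy_mono[of h k] anisotropy_diff_le[of h k]
        anisotropy_mono[of k h] anisotropy_diff_le[of k h] by (cases "h \<le> k") auto
    then show ?thesis
      using D by (simp add: abs_mult flip: right_diff_distrib)
  qed
  have "\<bar>\<rho> - \<sigma>\<bar> \<le> 3 * \<bar>norm I - norm J\<bar>"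
    using slope[OF h] D by (simp add: \<rho>_def \<sigma>_def)
  from norm_deviator_diff_le[OF n(1) m(1) bounds this, of v]
  show ?thesis
    unfolding n(3) m(3) \<rho>_def[symmetric] \<sigma>_def[symmetric] n(2)[symmetric] m(2)[symmetric]
    by simp
qed

text \<open>Let \<open>x\<close> be the change of \<open>D \<rho>(|I| / D)\<close>. Along \<open>n\<close> the difference is \<open>((E - D) + 2 x) / 3\<close>
  times the component of \<open>v\<close>, orthogonally to \<open>n\<close> it is \<open>((E - D) - x) / 3\<close> times it. Both
  factors lie between \<open>-(E - D)\<close> and \<open>E - D\<close> iff \<open>-2 (E - D) \<le> x \<le> E - D\<close>. The upper bound
  follows from the monotonicity of \<open>\<rho>\<close> and \<open>\<rho> \<le> 1\<close>, the lower one from the slope bound of \<open>\<rho>\<close>,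
  used once between the two states and once up to \<open>h = 1\<close>.\<close>

lemma pressure_density_lipschitz:
  assumes "norm I \<le> D" "D \<le> E"
  shows "norm (pressure (E, I) v - pressure (D, I) v) \<le> (E - D) * norm v"
proof -
  obtain n where n: "norm n = 1" "I = norm I *\<^sub>R n"
    and pD: "\<And>v. pressure (D, I) v =
       (D / 3) *\<^sub>R v + (D * anisotropy (norm I / D)) *\<^sub>R ((n \<bullet> v) *\<^sub>R n - (1 / 3) *\<^sub>R v)"
    using pressure_direction[where I = I and D = D] by blast
  have pE: "pressure (E, I) v =
       (E / 3) *\<^sub>R v + (E * anisotropy (norm I / E)) *\<^sub>R ((n \<bullet> v) *\<^sub>R n - (1 / 3) *\<^sub>R v)"
  proof (cases "I = 0")
    case False
    have "sgn I = n"
      using n False sgn_scaleR[of "norm I" n] by (simp add: sgn_div_norm)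
    then show ?thesis by (simp add: pressure_eq)
  qed (simp add: pressure_eq)
  define \<rho> \<sigma> where "\<rho> = D * anisotropy (norm I / D)" and "\<sigma> = E * anisotropy (norm I / E)"
  have D: "0 \<le> D" using assms norm_ge_zero order_trans by blast
  have \<sigma>: "- 2 * (E - D) \<le> \<sigma> - \<rho> \<and> \<sigma> - \<rho> \<le> E - D"
  proof (cases "D = 0")
    case True
    then show ?thesis using assms by (simp add: \<rho>_def \<sigma>_def)
  next
    case False
    then have pos: "D > 0" "E > 0" using D assms by auto
    define h k where "h = norm I / D" and "k = norm I / E"
    have hk: "0 \<le> k" "k \<le> h" "h \<le> 1"
      using pos assms by (auto simp: h_def k_def intro: divide_left_mono)
    have Dh: "D * h = E * k" using pos by (simp add: h_def k_def)
    have "D * (1 - anisotropy h) \<le> E * (1 - anisotropy k)"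
      using anisotropy_mono[of k h] anisotropy_le_1[of h] hk pos assms
      by (intro mult_mono) auto
    moreover have "D * (anisotropy h - anisotropy k) \<le> (E - D) * (anisotropy k + 2)"
    proof -
      have "D * (anisotropy h - anisotropy k) \<le> D * (3 * (h - k))"
        using anisotropy_diff_le[OF hk] pos by (intro mult_left_mono) auto
      also have "\<dots> = (E - D) * (3 * k)" using Dh by (simp add: algebra_simps)
      also have "\<dots> \<le> (E - D) * (anisotropy k + 2)"
        using anisotropy_diff_le[of k 1] hk assms by (intro mult_left_mono) auto
      finally show ?thesis .
    qed
    ultimately show ?thesis
      by (simp add: \<rho>_def \<sigma>_def h_def[symmetric] k_def[symmetric] algebra_simps)
  qed
  define a b t where "a = ((E - D) - (\<sigma> - \<rho>)) / 3" and "b = \<sigma> - \<rho>" and "t = n \<bullet> v"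
  have t: "t\<^sup>2 \<le> (norm v)\<^sup>2"
    using Cauchy_Schwarz_ineq2[of n v] n(1) unfolding abs_le_square_iff[symmetric] by (simp add: t_def)
  have "0 \<le> a" "a \<le> E - D" "- (E - D) \<le> a + b" "a + b \<le> E - D"
    using \<sigma> by (auto simp: a_def b_def field_simps)
  then have ab: "a\<^sup>2 \<le> (E - D)\<^sup>2" "(a + b)\<^sup>2 \<le> (E - D)\<^sup>2"
    unfolding abs_le_square_iff[symmetric] by auto
  have "pressure (E, I) v - pressure (D, I) v = a *\<^sub>R v + b *\<^sub>R (t *\<^sub>R n)"
    unfolding pE pD \<rho>_def[symmetric] \<sigma>_def[symmetric] t_def[symmetric]
    by (simp add: a_def b_def algebra_simps diff_divide_distrib add_divide_distrib)
  then have "(norm (pressure (E, I) v - pressure (D, I) v))\<^sup>2 = a\<^sup>2 * ((norm v)\<^sup>2 - t\<^sup>2) + (a + b)\<^sup>2 * t\<^sup>2"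
    using n(1) by (simp add: power2_norm_eq_inner inner_add_left inner_add_right norm_eq_1
      inner_commute[of v n] flip: t_def) (simp add: algebra_simps power2_eq_square)
  also have "\<dots> \<le> (E - D)\<^sup>2 * ((norm v)\<^sup>2 - t\<^sup>2) + (E - D)\<^sup>2 * t\<^sup>2"
    using ab t by (intro add_mono mult_right_mono) auto
  also have "\<dots> = ((E - D) * norm v)\<^sup>2" by (simp add: power_mult_distrib right_diff_distrib)
  finally show ?thesis
    by (rule power2_le_imp_le) (use assms in simp)
qed

text \<open>At fixed flux an increase of the density stays in the cone, a decrease need not; hence the
  state of smaller density is moved first in \<open>D\<close> and then in \<open>I\<close>.\<close>

lemma pressure_lipschitz:
  assumes "norm I \<le> D" "norm J \<le> E"
  shows "norm (pressure (D, I) v - pressure (E, J) v) \<le> (\<bar>D - E\<bar> + 2 * norm (I - J)) * norm v"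
proof -
  have *: "norm (pressure (D, I) v - pressure (E, J) v) \<le> (\<bar>D - E\<bar> + 2 * norm (I - J)) * norm v"
    if "norm I \<le> D" "norm J \<le> E" "D \<le> E" for D E I J
  proof -
    have "norm (pressure (D, I) v - pressure (E, J) v) \<le>
        norm (pressure (D, I) v - pressure (E, I) v) + norm (pressure (E, I) v - pressure (E, J) v)"
      using dist_triangle[of "pressure (D, I) v" "pressure (E, J) v" "pressure (E, I) v"]
      by (simp add: dist_norm)
    also have "\<dots> \<le> (E - D) * norm v + 2 * norm (I - J) * norm v"
      using that by (intro add_mono pressure_flux_lipschitz)
        (auto simp: norm_minus_commute[of "pressure (D, I) v"] intro: pressure_density_lipschitz)
    finally show ?thesis using that by (simp add: algebra_simps)
  qed
  from *[of I D J E] *[of J E I D] assms show ?thesis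
    by (cases "D \<le> E") (simp_all add: norm_minus_commute abs_minus_commute)
qed

section \<open>Realizability of weighted moments\<close>

lemma inner_pressure_commute: "m \<bullet> pressure M v = v \<bullet> pressure M m"
proof -
  obtain D I where M: "M = (D, I)" by (cases M)
  obtain n where "\<And>v. pressure (D, I) v =
       (D / 3) *\<^sub>R v + (D * anisotropy (norm I / D)) *\<^sub>R ((n \<bullet> v) *\<^sub>R n - (1 / 3) *\<^sub>R v)"
    using pressure_direction[where I = I and D = D] by blast
  then show ?thesis
    unfolding M by (simp only:) (simp add: inner_add_right inner_diff_right inner_commute)
qed

text \<open>If \<open>(D, I, P)\<close> are the moments of a nonnegative density on the unit sphere, then \<open>D - m \<bullet> I\<close> and
  \<open>I - P m\<close> are the zeroth and first moments of that density times the weight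
  \<open>1 - m \<bullet> \<omega> \<ge> 0\<close>. The proof is algebraic and uses only \<open>h\<^sup>2 \<le> \<psi>(h) \<le> 1\<close>. With \<open>D = 1\<close>,
  \<open>t = n \<bullet> m\<close> and \<open>a = (1 - \<psi>) / 2\<close>, the difference of the squares is
  \<open>(\<psi> - h\<^sup>2) (1 - t\<^sup>2) + a q(t)\<close> for a quadratic polynomial \<open>q\<close> that is nonnegative because
  \<open>h\<^sup>2 \<le> 1 - 2 a\<close>.\<close>

lemma norm_flux_diff_pressure_le:
  assumes "norm I \<le> D" "norm m = 1"
  shows "norm (I - pressure (D, I) m) \<le> D - m \<bullet> I"
proof (cases "D = 0")
  case True
  with assms show ?thesis by (simp add: pressure_def)
next
  case False
  with assms have D: "D > 0" by (smt (verit) norm_ge_zero)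
  obtain n where n: "norm n = 1" and I: "I = norm I *\<^sub>R n"
    and p: "\<And>v. pressure (D, I) v =
       (D / 3) *\<^sub>R v + (D * anisotropy (norm I / D)) *\<^sub>R ((n \<bullet> v) *\<^sub>R n - (1 / 3) *\<^sub>R v)"
    using pressure_direction[where I = I and D = D] by blast
  define h b a t where "h = norm I / D" and "b = anisotropy h" and "a = (1 - b) / 3" and "t = n \<bullet> m"
  have h: "0 \<le> h" "h \<le> 1" using D assms by (auto simp: h_def)
  have b: "b = 1 - 3 * a" by (simp add: a_def field_simps)
  have a: "0 \<le> a" using anisotropy_le_1[OF h] by (simp add: a_def b_def)
  have ha: "h\<^sup>2 \<le> 1 - 2 * a" using anisotropy_ge_square[OF h] by (simp add: a_def b_def field_simps)
  have t: "\<bar>t\<bar> \<le> 1" using Cauchy_Schwarz_ineq2[of n m] n assms(2) by (simp add: t_def)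
  have nn: "n \<bullet> n = 1" "m \<bullet> m = 1" using n assms(2) by (simp_all add: norm_eq_1)
  have Ih: "I = D *\<^sub>R (h *\<^sub>R n)" using I D by (simp add: h_def)
  have "I - pressure (D, I) m = D *\<^sub>R (h *\<^sub>R n - a *\<^sub>R m - (b * t) *\<^sub>R n)"
  proof -
    have "pressure (D, I) m = D *\<^sub>R (a *\<^sub>R m + (b * t) *\<^sub>R n)"
      by (simp add: p a_def b_def h_def t_def algebra_simps diff_divide_distrib)
    moreover have "I - pressure (D, I) m = D *\<^sub>R (h *\<^sub>R n) - pressure (D, I) m"
      by (simp only: Ih[symmetric])
    ultimately show ?thesis by (simp add: scaleR_diff_right scaleR_add_right)
  qed
  moreover have "norm (h *\<^sub>R n - a *\<^sub>R m - (b * t) *\<^sub>R n) \<le> 1 - h * t"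
  proof (rule power2_le_imp_le)
    have "(norm (h *\<^sub>R n - a *\<^sub>R m - (b * t) *\<^sub>R n))\<^sup>2 = (h - b * t)\<^sup>2 - 2 * a * (h - b * t) * t + a\<^sup>2"
      unfolding power2_norm_eq_inner
      by (simp add: inner_diff_left inner_diff_right nn inner_commute[of m n] flip: t_def)
         (simp add: algebra_simps power2_eq_square)
    also have "\<dots> = (1 - h * t)\<^sup>2 - ((1 - 2 * a - h\<^sup>2) * (1 - t\<^sup>2)
        + a * (2 - a + (2 - 3 * a) * t\<^sup>2 - 4 * h * t))"
      unfolding b by (simp add: algebra_simps power2_eq_square)
    also have "\<dots> \<le> (1 - h * t)\<^sup>2"
    proof -
      have t2: "t\<^sup>2 \<le> 1" using t by (simp add: abs_square_le_1)
      have "a \<le> 1 / 2" using ha zero_le_power2[of h] by linarith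
      \<comment> \<open>Completing the square: \<open>4 h\<^sup>2 \<le> (2 - a) (2 - 3 a)\<close> makes the discriminant nonpositive.\<close>
      have "(2 - a) * (2 - a + (2 - 3 * a) * t\<^sup>2 - 4 * h * t)
         = (2 - a - 2 * h * t)\<^sup>2 + (4 * (1 - 2 * a - h\<^sup>2) + 3 * a\<^sup>2) * t\<^sup>2"
        by (simp add: algebra_simps power2_eq_square)
      also have "\<dots> \<ge> 0" using ha by (intro add_nonneg_nonneg mult_nonneg_nonneg) auto
      finally have "0 \<le> 2 - a + (2 - 3 * a) * t\<^sup>2 - 4 * h * t"
        using \<open>a \<le> 1 / 2\<close> by (simp add: zero_le_mult_iff)
      then have "0 \<le> (1 - 2 * a - h\<^sup>2) * (1 - t\<^sup>2) + a * (2 - a + (2 - 3 * a) * t\<^sup>2 - 4 * h * t)"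
        using a ha t2 by (intro add_nonneg_nonneg mult_nonneg_nonneg) auto
      then show ?thesis by simp
    qed
    finally show "(norm (h *\<^sub>R n - a *\<^sub>R m - (b * t) *\<^sub>R n))\<^sup>2 \<le> (1 - h * t)\<^sup>2" .
    have "\<bar>h * t\<bar> \<le> 1 * 1" unfolding abs_mult using h t by (intro mult_mono) auto
    then show "0 \<le> 1 - h * t" by simp
  qed
  ultimately have "norm (I - pressure (D, I) m) \<le> D * (1 - h * t)"
    using D by simp
  also have "\<dots> = D - m \<bullet> I"
    by (subst Ih) (simp add: t_def inner_commute algebra_simps)
  finally show ?thesis .
qed

text \<open>Realizability of the moments weighted by \<open>s + w \<bullet> \<omega> \<ge> 0\<close>. Testing the vector with its own
  direction \<open>m\<close> and using the symmetry of the pressure leaves the term \<open>w \<bullet> (I - P m)\<close>, which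
  the preceding lemma controls.\<close>

lemma norm_weighted_flux_le:
  assumes "norm I \<le> D" "norm w \<le> s"
  shows "norm (s *\<^sub>R I + pressure (D, I) w) \<le> s * D + w \<bullet> I"
proof (cases "s *\<^sub>R I + pressure (D, I) w = 0")
  case True
  have "\<bar>w \<bullet> I\<bar> \<le> norm w * norm I" by (rule Cauchy_Schwarz_ineq2)
  also have "\<dots> \<le> s * D"
    using assms order_trans[OF norm_ge_zero assms(2)] by (intro mult_mono) auto
  finally show ?thesis using True by simp
next
  case False
  define X where "X = s *\<^sub>R I + pressure (D, I) w"
  define m where "m = sgn X"
  have m: "norm m = 1" using False by (simp add: m_def X_def norm_sgn)
  have "norm X = m \<bullet> X"
    using False unfolding X_def[symmetric]
    by (simp add: m_def sgn_div_norm dot_square_norm power2_eq_square)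
  also have "\<dots> = s * (m \<bullet> I) + w \<bullet> I - w \<bullet> (I - pressure (D, I) m)"
    by (simp add: X_def inner_add_right inner_diff_right inner_pressure_commute[of m])
  also have "\<dots> \<le> s * (m \<bullet> I) + w \<bullet> I + s * (D - m \<bullet> I)"
  proof -
    have "\<bar>w \<bullet> (I - pressure (D, I) m)\<bar> \<le> norm w * norm (I - pressure (D, I) m)"
      by (rule Cauchy_Schwarz_ineq2)
    also have "\<dots> \<le> s * (D - m \<bullet> I)"
      using assms order_trans[OF norm_ge_zero assms(2)] norm_flux_diff_pressure_le[OF assms(1) m]
      by (intro mult_mono) auto
    finally show ?thesis by simp
  qed
  finally show ?thesis by (simp add: X_def algebra_simps)
qed

text \<open>With \<open>a = |D - E|\<close> and \<open>b = |I - J|\<close> the two components change by at most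
  \<open>b |v|\<close> and \<open>(a + 2 b) |v|\<close>. The symmetric matrix with rows \<open>(0, 1)\<close> and \<open>(1, 2)\<close> has
  eigenvalues \<open>1 + sqrt 2\<close> and \<open>1 - sqrt 2\<close>, hence norm \<open>1 + sqrt 2\<close>.\<close>

lemma moment_flux_lipschitz:
  assumes "norm I \<le> D" "norm J \<le> E"
  shows "norm ((v \<bullet> I, pressure (D, I) v) - (v \<bullet> J, pressure (E, J) v))
    \<le> (1 + sqrt 2) * norm v * norm ((D, I) - (E, J))"
proof -
  define a b where "a = \<bar>D - E\<bar>" and "b = norm (I - J)"
  have ab: "a \<ge> 0" "b \<ge> 0" by (simp_all add: a_def b_def)
  have "\<bar>v \<bullet> (I - J)\<bar> \<le> norm v * b"
    unfolding b_def by (rule Cauchy_Schwarz_ineq2)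
  then have "(v \<bullet> (I - J))\<^sup>2 \<le> (b * norm v)\<^sup>2"
    using ab by (simp add: abs_le_square_iff[symmetric] mult.commute)
  moreover have "(norm (pressure (D, I) v - pressure (E, J) v))\<^sup>2 \<le> (a + 2 * b)\<^sup>2 * (norm v)\<^sup>2"
    using power_mono[OF pressure_lipschitz[OF assms, of v] norm_ge_zero, of 2]
    unfolding a_def b_def power_mult_distrib .
  ultimately have "(norm ((v \<bullet> I, pressure (D, I) v) - (v \<bullet> J, pressure (E, J) v)))\<^sup>2
      \<le> (b\<^sup>2 + (a + 2 * b)\<^sup>2) * (norm v)\<^sup>2"
    by (simp add: norm_prod_def inner_diff_right power_mult_distrib
      distrib_right[of "b\<^sup>2"])
  also have "\<dots> \<le> ((1 + sqrt 2)\<^sup>2 * (a\<^sup>2 + b\<^sup>2)) * (norm v)\<^sup>2"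
  proof (rule mult_right_mono)
    have "(1 + sqrt 2)\<^sup>2 * (a\<^sup>2 + b\<^sup>2) - (b\<^sup>2 + (a + 2 * b)\<^sup>2)
        = 2 * (sqrt 2 + 1) * (a - (sqrt 2 - 1) * b)\<^sup>2"
    proof -
      define r where "r = sqrt (2::real)"
      have "r * r - 2 = 0" by (simp add: r_def)
      moreover have "(1 + r)\<^sup>2 * (a\<^sup>2 + b\<^sup>2) - (b\<^sup>2 + (a + 2 * b)\<^sup>2)
          - 2 * (r + 1) * (a - (r - 1) * b)\<^sup>2
          = (r * r - 2) * (a\<^sup>2 + 4 * a * b + (3 - 2 * r) * b\<^sup>2)"
        by (simp add: algebra_simps power2_eq_square)
      ultimately show ?thesis unfolding r_def[symmetric] by simp
    qed
    also have "\<dots> \<ge> 0" by simp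
    finally show "b\<^sup>2 + (a + 2 * b)\<^sup>2 \<le> (1 + sqrt 2)\<^sup>2 * (a\<^sup>2 + b\<^sup>2)" by simp
  qed simp
  also have "\<dots> = ((1 + sqrt 2) * norm v * norm ((D, I) - (E, J)))\<^sup>2"
    by (simp add: norm_prod_def power_mult_distrib a_def b_def)
  finally show ?thesis by (rule power2_le_imp_le) simp
qed

section \<open>The iteration\<close>

text \<open>The realizable set with its apex \<open>(0, 0)\<close>. The contraction principle needs this complete set;
  at the apex the flux factor is the quotient \<open>0 / 0 = 0\<close>, and the factor \<open>D\<close> makes the
  pressure vanish.\<close>

definition realizable_closure :: "(real \<times> (real ^ 3)) set" where
  "realizable_closure = {(D, I). norm I \<le> D}"

lemma complete_realizable_closure: "complete realizable_closure"
proof -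
  have "closed {M :: real \<times> (real ^ 3). norm (snd M) \<le> fst M}"
    by (intro closed_Collect_le continuous_intros)
  then show ?thesis
    by (simp add: realizable_closure_def case_prod_unfold complete_eq_closed)
qed

lemma realizable_subset_closure: "realizable \<subseteq> realizable_closure"
  by (auto simp: realizable_def realizable_closure_def)

lemma damping_bounds:
  "0 < damping lam dt s" "damping lam dt s \<le> 1"
  if "0 \<le> lam" "0 \<le> dt" "0 \<le> s"
  using that by (auto simp: damping_def inverse_le_1_iff add_pos_nonneg)

lemma damping_antimono:
  "damping lam dt t \<le> damping lam dt s"
  if "0 \<le> lam" "0 \<le> dt" "0 \<le> s" "s \<le> t"
  unfolding damping_def using that
  by (intro le_imp_inverse_le add_left_mono mult_left_mono add_pos_nonneg) auto

lemma iteration_map_eq: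
  "iteration_map v lam dt chi kappa D0 (N, G) (D, I) =
     (damping lam dt chi * ((1 - lam) * D + lam * (- (v \<bullet> I) + N + dt * chi * D0)),
      damping lam dt kappa *\<^sub>R ((1 - lam) *\<^sub>R I + lam *\<^sub>R (- pressure (D, I) v + G)))"
  by (simp add: iteration_map_def pressure_def)

lemma conserved_eq: "conserved v (D, I) = (D + v \<bullet> I, I + pressure (D, I) v)"
  by (simp add: conserved_def pressure_def)

lemma pressure_scaleR: "pressure M (c *\<^sub>R v) = c *\<^sub>R pressure M v"
proof (cases M)
  case (Pair D I)
  then show ?thesis by (simp add: pressure_eq algebra_simps)
qed

lemma norm_Pair_scale_le:
  fixes x :: "'a :: real_normed_vector" and y :: "'b :: real_normed_vector"
  assumes "\<bar>a\<bar> \<le> 1" "\<bar>b\<bar> \<le> 1"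
  shows "norm (a *\<^sub>R x, b *\<^sub>R y) \<le> norm (x, y)"
proof -
  have "(\<bar>a\<bar> * norm x)\<^sup>2 \<le> (norm x)\<^sup>2" "(\<bar>b\<bar> * norm y)\<^sup>2 \<le> (norm y)\<^sup>2"
    using assms by (auto intro!: power_mono mult_left_le_one_le)
  then show ?thesis
    unfolding norm_prod_def by (auto intro!: real_sqrt_le_mono add_mono)
qed

lemma iteration_map_contraction:
  assumes "0 \<le> lam" "lam \<le> 1" "0 \<le> dt" "0 \<le> chi" "0 \<le> kappa"
    and "M \<in> realizable_closure" "M' \<in> realizable_closure"
  shows "dist (iteration_map v lam dt chi kappa D0 U M) (iteration_map v lam dt chi kappa D0 U M')
    \<le> (1 - lam + lam * ((1 + sqrt 2) * norm v)) * dist M M'"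
proof -
  obtain N G D I E J where eqs: "U = (N, G)" "M = (D, I)" "M' = (E, J)"
    by (cases U, cases M, cases M')
  have cone: "norm I \<le> D" "norm J \<le> E" using assms by (auto simp: realizable_closure_def eqs)
  define F where "F = (v \<bullet> I, pressure (D, I) v) - (v \<bullet> J, pressure (E, J) v)"
  define Z where "Z = (1 - lam) *\<^sub>R ((D, I) - (E, J)) - lam *\<^sub>R F"
  have "iteration_map v lam dt chi kappa D0 U M - iteration_map v lam dt chi kappa D0 U M'
     = (damping lam dt chi *\<^sub>R fst Z, damping lam dt kappa *\<^sub>R snd Z)"
    by (simp add: eqs iteration_map_eq Z_def F_def algebra_simps)
  then have "dist (iteration_map v lam dt chi kappa D0 U M) (iteration_map v lam dt chi kappa D0 U M')
     \<le> norm (fst Z, snd Z)"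
    unfolding dist_norm using damping_bounds[of lam dt chi] damping_bounds[of lam dt kappa] assms
    by (simp only:) (rule norm_Pair_scale_le; simp)
  also have "\<dots> \<le> (1 - lam) * norm ((D, I) - (E, J)) + lam * norm F"
    using norm_triangle_ineq4[of "(1 - lam) *\<^sub>R ((D, I) - (E, J))" "lam *\<^sub>R F"] assms
    unfolding prod.collapse Z_def norm_scaleR by simp
  also have "\<dots> \<le> (1 - lam) * norm ((D, I) - (E, J))
      + lam * ((1 + sqrt 2) * norm v * norm ((D, I) - (E, J)))"
    unfolding F_def using moment_flux_lipschitz[OF cone] assms by (intro add_left_mono mult_left_mono) auto
  also have "\<dots> = (1 - lam + lam * ((1 + sqrt 2) * norm v)) * dist M M'"
    by (simp add: eqs dist_norm algebra_simps del: diff_Pair)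
  finally show ?thesis .
qed

text \<open>The undamped update is the sum of \<open>\<lambda> U\<close>, a nonnegative source in the density, and the moments
  weighted by \<open>(1 - \<lambda>) - \<lambda> v \<bullet> \<omega>\<close>, where \<open>\<lambda> |v| \<le> 1 - \<lambda>\<close>. The damping preserves the
  cone because the larger opacity acts on the flux.\<close>

lemma iteration_map_in_closure:
  assumes "0 \<le> lam" "lam \<le> 1" "lam \<le> 1 / (1 + norm v)" "0 \<le> chi" "chi \<le> kappa" "0 \<le> dt" "0 \<le> D0"
    and "U \<in> realizable_closure" "M \<in> realizable_closure"
  shows "iteration_map v lam dt chi kappa D0 U M \<in> realizable_closure"
proof -
  obtain N G D I where eqs: "U = (N, G)" "M = (D, I)" by (cases U, cases M)
  have cone: "norm I \<le> D" "norm G \<le> N" using assms by (auto simp: realizable_closure_def eqs)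
  define X where "X = (1 - lam) *\<^sub>R I + lam *\<^sub>R (- pressure (D, I) v + G)"
  define Y where "Y = (1 - lam) * D + lam * (- (v \<bullet> I) + N + dt * chi * D0)"
  have "0 < 1 + norm v" using norm_ge_zero[of v] by linarith
  then have "lam * norm v \<le> 1 - lam"
    using assms(3) by (simp add: field_simps)
  then have "norm ((1 - lam) *\<^sub>R I + pressure (D, I) ((- lam) *\<^sub>R v)) \<le> (1 - lam) * D + ((- lam) *\<^sub>R v) \<bullet> I"
    using assms by (intro norm_weighted_flux_le cone) auto
  then have "norm ((1 - lam) *\<^sub>R I - lam *\<^sub>R pressure (D, I) v) \<le> (1 - lam) * D - lam * (v \<bullet> I)"
    unfolding pressure_scaleR by simp
  moreover have "norm (lam *\<^sub>R G) \<le> lam * N" using cone assms by (simp add: mult_left_mono)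
  moreover have "0 \<le> lam * (dt * chi * D0)" using assms by simp
  moreover have "norm X \<le> norm ((1 - lam) *\<^sub>R I - lam *\<^sub>R pressure (D, I) v) + norm (lam *\<^sub>R G)"
    unfolding X_def
    by (rule order_trans[OF _ norm_triangle_ineq]) (simp add: algebra_simps)
  moreover have "Y = ((1 - lam) * D - lam * (v \<bullet> I)) + lam * N + lam * (dt * chi * D0)"
    by (simp add: Y_def algebra_simps)
  ultimately have "norm X \<le> Y" by linarith
  then have "damping lam dt kappa * norm X \<le> damping lam dt chi * Y"
    using damping_antimono[of lam dt chi kappa] damping_bounds[of lam dt kappa]
      damping_bounds[of lam dt chi] assms by (intro mult_mono) auto
  moreover have "0 < damping lam dt kappa" using damping_bounds[of lam dt kappa] assms by simp
  moreover have "iteration_map v lam dt chi kappa D0 U M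
      = (damping lam dt chi * Y, damping lam dt kappa *\<^sub>R X)"
    by (simp only: eqs iteration_map_eq X_def Y_def)
  ultimately show ?thesis
    by (simp add: realizable_closure_def)
qed

lemma contraction_iterates_tendsto:
  fixes f :: "'a :: metric_space \<Rightarrow> 'a"
  assumes "0 \<le> c" "c < 1" "f ` S \<subseteq> S" "\<And>x y. x \<in> S \<Longrightarrow> y \<in> S \<Longrightarrow> dist (f x) (f y) \<le> c * dist x y"
    and "p \<in> S" "f p = p" "x \<in> S"
  shows "(\<lambda>k. (f ^^ k) x) \<longlonglongrightarrow> p"
proof -
  have in_S: "(f ^^ k) x \<in> S" for k
    using assms by (induction k) auto
  have "dist ((f ^^ k) x) p \<le> c ^ k * dist x p" for k
  proof (induction k)
    case (Suc k)
    have "dist ((f ^^ Suc k) x) p \<le> c * dist ((f ^^ k) x) p"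
      using assms(4)[OF in_S[of k] assms(5)] assms(6) by simp
    also have "\<dots> \<le> c * (c ^ k * dist x p)"
      using Suc assms(1) by (rule mult_left_mono)
    finally show ?case by simp
  qed simp
  moreover have "(\<lambda>k. c ^ k * dist x p) \<longlonglongrightarrow> 0"
    using LIMSEQ_power_zero[of c] assms by (auto intro: tendsto_mult_left_zero)
  ultimately have "(\<lambda>k. dist ((f ^^ k) x) p) \<longlonglongrightarrow> 0"
    by (intro Lim_null_comparison[of "\<lambda>k. dist ((f ^^ k) x) p"] always_eventually) simp_all
  then show ?thesis by (subst tendsto_dist_iff)
qed

lemma damping_scaleR_eqD:
  "x = (1 + lam * dt * s) *\<^sub>R y"
  if "0 < lam" "0 \<le> dt" "0 \<le> s" "damping lam dt s *\<^sub>R x = y" for x y :: "'a :: real_vector"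
proof -
  define c where "c = 1 + lam * dt * s"
  have "0 \<le> lam * dt * s" using that by simp
  then have "c \<noteq> 0" unfolding c_def by linarith
  then show ?thesis
    using that(4)[symmetric] unfolding damping_def c_def[symmetric] by simp
qed

lemma fixpoint_solves_implicit_system:
  assumes "0 < lam" "0 \<le> dt" "0 \<le> chi" "0 \<le> kappa"
    and fixed: "iteration_map v lam dt chi kappa D0 U M = M"
  shows "conserved v M = U + dt *\<^sub>R (chi * (D0 - fst M), - (kappa *\<^sub>R snd M))"
proof -
  obtain N G D I where eqs: "U = (N, G)" "M = (D, I)" by (cases U, cases M)
  have "lam *\<^sub>R (D + v \<bullet> I) = lam *\<^sub>R (N + dt * (chi * (D0 - D)))"
    using damping_scaleR_eqD[OF assms(1,2,3), of "(1 - lam) * D + lam * (- (v \<bullet> I) + N + dt * chi * D0)" D] fixed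
    by (simp add: eqs iteration_map_eq algebra_simps)
  moreover have "lam *\<^sub>R (I + pressure (D, I) v) = lam *\<^sub>R (G - (dt * kappa) *\<^sub>R I)"
    using damping_scaleR_eqD[OF assms(1,2,4), of "(1 - lam) *\<^sub>R I + lam *\<^sub>R (- pressure (D, I) v + G)" I] fixed
    by (simp add: eqs iteration_map_eq algebra_simps)
  ultimately show ?thesis
    using assms(1) by (simp add: eqs conserved_eq)
qed

text \<open>At the apex \<open>(0, 0)\<close> the conserved moments vanish, whereas the implicit system gives them
  the positive density \<open>N + \<Delta>t \<chi> D\<^sub>0\<close>.\<close>

lemma fixpoint_realizable:
  assumes "0 < lam" "0 \<le> dt" "0 \<le> chi" "0 \<le> kappa" "0 \<le> D0"
    and "U \<in> realizable" "M \<in> realizable_closure"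
    and fixed: "iteration_map v lam dt chi kappa D0 U M = M"
  shows "M \<in> realizable"
proof (rule ccontr)
  assume "M \<notin> realizable"
  then have "M = (0, 0)"
    using assms(7) by (auto simp: realizable_def realizable_closure_def) (smt (verit) norm_ge_zero norm_le_zero_iff)+
  moreover have "0 \<le> dt * (chi * D0)" using assms by simp
  ultimately show False
    using fixpoint_solves_implicit_system[OF assms(1-4) fixed] assms(6)
    by (auto simp: conserved_eq realizable_def)
qed

lemma conserved_realizable:
  assumes "norm v < 1" "M \<in> realizable"
  shows "conserved v M \<in> realizable"
proof -
  obtain D I where M: "M = (D, I)" by (cases M)
  then have DI: "0 < D" "norm I \<le> D" using assms(2) by (auto simp: realizable_def)
  have "\<bar>v \<bullet> I\<bar> \<le> norm v * norm I" by (rule Cauchy_Schwarz_ineq2)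
  also have "\<dots> \<le> norm v * D" using DI by (intro mult_left_mono) auto
  also have "\<dots> < D" using DI assms(1) by simp
  finally have "0 < D + v \<bullet> I" by simp
  moreover have "norm (1 *\<^sub>R I + pressure (D, I) v) \<le> 1 * D + v \<bullet> I"
    using assms(1) DI by (intro norm_weighted_flux_le) auto
  ultimately show ?thesis by (simp add: M conserved_eq realizable_def)
qed

theorem theorem3:
  fixes v :: "real ^ 3" and lam dt chi kappa D0 :: real and Ustar :: "real \<times> (real ^ 3)"
  assumes "norm v < sqrt 2 - 1"
    and "0 < lam" and "lam \<le> 1" and "lam \<le> 1 / (1 + norm v)"
    and "0 \<le> chi" and "chi \<le> kappa"
    and "0 \<le> dt" and "0 \<le> D0"
    and "Ustar \<in> realizable"
  shows "\<exists>!M. M \<in> realizable \<and>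
    (\<forall>M0\<in>realizable.
       (\<lambda>k. (iteration_map v lam dt chi kappa D0 Ustar ^^ k) M0) \<longlonglongrightarrow> M) \<and>
    conserved v M \<in> realizable \<and>
    conserved v M = Ustar + dt *\<^sub>R (chi * (D0 - fst M), - (kappa *\<^sub>R snd M))"
proof -
  let ?Q = "iteration_map v lam dt chi kappa D0 Ustar"
  define c where "c = 1 - lam + lam * ((1 + sqrt 2) * norm v)"
  have "(1 + sqrt 2) * norm v < (1 + sqrt 2) * (sqrt 2 - 1)"
    using assms(1) by (intro mult_strict_left_mono) (auto simp: add_pos_nonneg)
  also have "\<dots> = 1" by (simp add: algebra_simps)
  finally have "lam * ((1 + sqrt 2) * norm v) < lam * 1"
    using assms(2) by (rule mult_strict_left_mono)
  then have c: "0 \<le> c" "c < 1" using assms by (auto simp: c_def)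
  have kappa: "0 \<le> kappa" using assms by simp
  have Q_closure: "?Q ` realizable_closure \<subseteq> realizable_closure"
    using assms realizable_subset_closure by (auto intro!: iteration_map_in_closure)
  have contraction: "dist (?Q M) (?Q M') \<le> c * dist M M'"
    if "M \<in> realizable_closure" "M' \<in> realizable_closure" for M M'
    unfolding c_def using assms kappa that by (intro iteration_map_contraction) auto
  have "realizable_closure \<noteq> {}" using assms(9) realizable_subset_closure by blast
  from Banach_fix[OF complete_realizable_closure this c Q_closure contraction]
  obtain M where M: "M \<in> realizable_closure" "?Q M = M" by blast
  have lim: "(\<lambda>k. (?Q ^^ k) M0) \<longlonglongrightarrow> M" if "M0 \<in> realizable" for M0
    using contraction_iterates_tendsto[OF c Q_closure contraction M] that realizable_subset_closure by blast
  have real: "M \<in> realizable"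
    by (rule fixpoint_realizable[OF assms(2,7,5) kappa assms(8,9) M])
  have "sqrt 2 \<le> (2 :: real)" by (rule real_le_lsqrt) auto
  then have "norm v < 1" using assms(1) by linarith
  show ?thesis
  proof (rule ex1I[of _ M], intro conjI ballI)
    show "conserved v M = Ustar + dt *\<^sub>R (chi * (D0 - fst M), - (kappa *\<^sub>R snd M))"
      by (rule fixpoint_solves_implicit_system[OF assms(2,7,5) kappa M(2)])
    show "conserved v M \<in> realizable"
      using \<open>norm v < 1\<close> real by (rule conserved_realizable)
  next
    fix M'
    assume "M' \<in> realizable \<and>
      (\<forall>M0\<in>realizable. (\<lambda>k. (?Q ^^ k) M0) \<longlonglongrightarrow> M') \<and>
      conserved v M' \<in> realizable \<and>
      conserved v M' = Ustar + dt *\<^sub>R (chi * (D0 - fst M'), - (kappa *\<^sub>R snd M'))"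
    then show "M' = M"
      using LIMSEQ_unique lim real by blast
  qed (use lim real in auto)
qed

end
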